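(* Let $(V,H,L)$ be a holonomic space. Then $$d_L(u,v)=\inf_{a\in H}\left\{\sqrt{L^2(a)+\|u-av\|^2}\right\}$$ is a metric on $V$.
   Context: A group-norm on a group $G$ is a function $N:G\to\mathbb{R}$ such that $N(A)\ge 0$; $N(A)=0$ if and only if $A$ is the identity; $N(A^{-1})=N(A)$; and $N(AB)\le N(A)+N(B)$, for all $A,B\in G$. A triplet $(V,H,L)$, with $V$ a normed vector space, $H$ a subgroup of the group of norm-preserving linear automorphisms of $V$, and $L:H\to\mathbb{R}$ a group-norm on $H$, is a holonomic space if: for all $u\in V$ there exists $r>0$ such that for all $v,w\in V$ with $\|v-u\|<r$, $\|w-u\|<r$, and all $A\in H$, $$\|v-w\|^2-\|v-Aw\|^2\le L^2(A).$$ *)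

theory Defs
  imports "HOL-Algebra.Group" "HOL-Analysis.Analysis"
begin

locale group_norm = group G for G (structure) +
  fixes N :: "'a \<Rightarrow> real"
  assumes nonneg: "A \<in> carrier G \<Longrightarrow> 0 \<le> N A"
    and eq_zero_iff: "A \<in> carrier G \<Longrightarrow> N A = 0 \<longleftrightarrow> A = \<one>"
    and norm_inv: "A \<in> carrier G \<Longrightarrow> N (inv A) = N A"
    and norm_mult_le: "\<lbrakk>A \<in> carrier G; B \<in> carrier G\<rbrakk> \<Longrightarrow> N (A \<otimes> B) \<le> N A + N B"

definition linear_isometry_group :: "('v::real_normed_vector \<Rightarrow> 'v) monoid" where
  "linear_isometry_group =
     \<lparr>carrier = {f. linear f \<and> bij f \<and> (\<forall>x. norm (f x) = norm x)}, monoid.mult = (\<circ>), one = id\<rparr>"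

lemma group_linear_isometry_group: "group linear_isometry_group"
proof (rule groupI)
  fix f :: "'a \<Rightarrow> 'a" assume "f \<in> carrier linear_isometry_group"
  then have f: "linear f" "bij f" "\<And>x. norm (f x) = norm x"
    by (auto simp: linear_isometry_group_def)
  have "linear (Hilbert_Choice.inv f)"
  proof (rule linearI)
    fix x y :: 'a and c :: real
    note [simp] = bij_is_surj[OF f(2), THEN surj_f_inv_f]
    have "f (Hilbert_Choice.inv f (x + y))
        = f (Hilbert_Choice.inv f x + Hilbert_Choice.inv f y)"
      using f(1) by (simp add: linear_add)
    then show "Hilbert_Choice.inv f (x + y) = Hilbert_Choice.inv f x + Hilbert_Choice.inv f y"
      using bij_is_inj[OF f(2)] by (simp only: inj_eq)
    have "f (Hilbert_Choice.inv f (c *\<^sub>R x)) = f (c *\<^sub>R Hilbert_Choice.inv f x)"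
      using f(1) by (simp add: linear_scale)
    then show "Hilbert_Choice.inv f (c *\<^sub>R x) = c *\<^sub>R Hilbert_Choice.inv f x"
      using bij_is_inj[OF f(2)] by (simp only: inj_eq)
  qed
  moreover have "norm (Hilbert_Choice.inv f x) = norm x" for x
    using f(3)[of "Hilbert_Choice.inv f x"] f(2) by (simp add: bij_is_surj surj_f_inv_f)
  ultimately show "\<exists>g\<in>carrier linear_isometry_group. g \<otimes>\<^bsub>linear_isometry_group\<^esub> f = \<one>\<^bsub>linear_isometry_group\<^esub>"
    using f(2)
    by (intro bexI[of _ "Hilbert_Choice.inv f"])
       (auto simp: linear_isometry_group_def bij_imp_bij_inv inv_o_cancel bij_is_inj)
qed (auto simp: linear_isometry_group_def linear_compose bij_comp comp_assoc linear_id)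

locale holonomic_space =
  fixes H :: "('v::real_normed_vector \<Rightarrow> 'v) set"
    and L :: "('v \<Rightarrow> 'v) \<Rightarrow> real"
  assumes subgroup_H: "subgroup H linear_isometry_group"
    and group_norm_L: "group_norm (linear_isometry_group\<lparr>carrier := H\<rparr>) L"
    and local_estimate: "\<exists>r>0. \<forall>v w. \<forall>A\<in>H. norm (v - u) < r \<longrightarrow> norm (w - u) < r \<longrightarrow>
           (norm (v - w))\<^sup>2 - (norm (v - A w))\<^sup>2 \<le> (L A)\<^sup>2"

definition holonomic_dist ::
  "('v::real_normed_vector \<Rightarrow> 'v) set \<Rightarrow> (('v \<Rightarrow> 'v) \<Rightarrow> real) \<Rightarrow> 'v \<Rightarrow> 'v \<Rightarrow> real" where
  "holonomic_dist H L u v = (INF a\<in>H. sqrt ((L a)\<^sup>2 + (norm (u - a v))\<^sup>2))"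

end

theory Submission
  imports Defs
begin

text \<open>Minkowski's inequality in the plane gives the triangle inequality. For definiteness, suppose
  that \<open>holonomic_dist H L u v = 0\<close>. The maps in \<open>H\<close> are linear, so elements \<open>a\<close> with \<open>L a\<close> and
  \<open>u - a v\<close> both small also make \<open>t u - a (t v)\<close> small. For small \<open>t > 0\<close> both \<open>t u\<close> and \<open>t v\<close>
  lie in the ball around the origin on which the local estimate holds, and the estimate forces
  \<open>t u = t v\<close>.\<close>

context holonomic_space
begin

lemma linear_H: "a \<in> H \<Longrightarrow> linear a"
  and norm_H: "a \<in> H \<Longrightarrow> norm (a x) = norm x"
  using subgroup.subset[OF subgroup_H] by (auto simp: linear_isometry_group_def)

lemma id_in_H: "id \<in> H"
  using subgroup.one_closed[OF subgroup_H] by (simp add: linear_isometry_group_def)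

lemma comp_in_H: "a \<in> H \<Longrightarrow> b \<in> H \<Longrightarrow> a \<circ> b \<in> H"
  using subgroup.m_closed[OF subgroup_H] by (simp add: linear_isometry_group_def)

lemma L_nonneg: "a \<in> H \<Longrightarrow> 0 \<le> L a"
  using group_norm.nonneg[OF group_norm_L] by simp

lemma L_id: "L id = 0"
  using group_norm.eq_zero_iff[OF group_norm_L, of id] id_in_H
  by (simp add: linear_isometry_group_def)

lemma L_comp_le: "a \<in> H \<Longrightarrow> b \<in> H \<Longrightarrow> L (a \<circ> b) \<le> L a + L b"
  using group_norm.norm_mult_le[OF group_norm_L, of a b] by (simp add: linear_isometry_group_def)

text \<open>Restates the group inverse as a pointwise left inverse, the form needed to move a map
  from one argument of the distance to the other.\<close>

lemma inverse_in_H: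
  assumes "a \<in> H"
  obtains b where "b \<in> H" "L b = L a" "\<And>x. b (a x) = x"
proof -
  let ?G = "linear_isometry_group\<lparr>carrier := H\<rparr>"
  interpret group_norm ?G L by (rule group_norm_L)
  have a: "a \<in> carrier ?G" using assms by simp
  have "(inv\<^bsub>?G\<^esub> a) \<circ> a = id"
    using l_inv[OF a] by (simp add: linear_isometry_group_def)
  with inv_closed[OF a] norm_inv[OF a] that show thesis
    by (simp add: fun_eq_iff)
qed

lemma bdd_below_holonomic:
  "bdd_below ((\<lambda>a. sqrt ((L a)\<^sup>2 + (norm (u - a v))\<^sup>2)) ` H)"
  by (rule bdd_belowI[of _ 0]) auto

lemma holonomic_dist_le:
  "a \<in> H \<Longrightarrow> holonomic_dist H L u v \<le> sqrt ((L a)\<^sup>2 + (norm (u - a v))\<^sup>2)"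
  unfolding holonomic_dist_def by (rule cINF_lower[OF bdd_below_holonomic])

lemma holonomic_dist_greatest:
  assumes "\<And>a. a \<in> H \<Longrightarrow> c \<le> sqrt ((L a)\<^sup>2 + (norm (u - a v))\<^sup>2)"
  shows "c \<le> holonomic_dist H L u v"
  unfolding holonomic_dist_def using assms id_in_H by (intro cINF_greatest) auto

text \<open>The infimum need not be attained, so near-minimizers stand in for a minimizer.\<close>

lemma holonomic_dist_lessE:
  assumes "holonomic_dist H L u v < c"
  obtains a where "a \<in> H" "sqrt ((L a)\<^sup>2 + (norm (u - a v))\<^sup>2) < c"
  using assms holonomic_dist_greatest[of c u v] by (meson not_less)

lemma holonomic_dist_nonneg: "0 \<le> holonomic_dist H L u v"
  by (rule holonomic_dist_greatest) simp

lemma holonomic_dist_self: "holonomic_dist H L u u = 0"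
  using holonomic_dist_le[OF id_in_H, of u u] holonomic_dist_nonneg[of u u] by (simp add: L_id)

text \<open>Each \<open>a\<close> competing for the pair \<open>v\<close>, \<open>u\<close> has an
  inverse competing for \<open>u\<close>, \<open>v\<close> at the same cost: it is an isometry with
  the same \<open>L\<close>. Equality follows by exchanging \<open>u\<close> and
  \<open>v\<close>.\<close>

lemma holonomic_dist_commute_le: "holonomic_dist H L u v \<le> holonomic_dist H L v u"
proof (rule holonomic_dist_greatest)
  fix a assume a: "a \<in> H"
  obtain b where b: "b \<in> H" "L b = L a" "\<And>x. b (a x) = x"
    using inverse_in_H[OF a] by blast
  have "norm (u - b v) = norm (b (a u - v))"
    by (simp add: linear_diff[OF linear_H[OF b(1)]] b(3))
  also have "\<dots> = norm (v - a u)"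
    by (simp add: norm_H[OF b(1)] norm_minus_commute)
  finally show "holonomic_dist H L u v \<le> sqrt ((L a)\<^sup>2 + (norm (v - a u))\<^sup>2)"
    using holonomic_dist_le[OF b(1), of u v] b(2) by simp
qed

lemma holonomic_dist_comp_le:
  assumes a: "a \<in> H" and b: "b \<in> H"
  shows "holonomic_dist H L u w
    \<le> sqrt ((L a)\<^sup>2 + (norm (u - a v))\<^sup>2) + sqrt ((L b)\<^sup>2 + (norm (v - b w))\<^sup>2)"
proof -
  \<comment> \<open>The detour passes through \<open>a v\<close>; since \<open>a\<close> is an
    isometry, the second leg has the norm of \<open>v - b w\<close>.\<close>
  have "u - (a \<circ> b) w = (u - a v) + a (v - b w)"
    by (simp add: linear_diff[OF linear_H[OF a]])
  then have "norm (u - (a \<circ> b) w) \<le> norm (u - a v) + norm (v - b w)"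
    by (metis norm_H[OF a] norm_triangle_ineq)
  moreover have "L (a \<circ> b) \<le> L a + L b" "0 \<le> L (a \<circ> b)"
    using a b by (simp_all add: L_comp_le L_nonneg comp_in_H)
  ultimately have "sqrt ((L (a \<circ> b))\<^sup>2 + (norm (u - (a \<circ> b) w))\<^sup>2)
      \<le> sqrt ((L a + L b)\<^sup>2 + (norm (u - a v) + norm (v - b w))\<^sup>2)"
    by (intro real_sqrt_le_mono add_mono power_mono) auto
  also have "\<dots> \<le> sqrt ((L a)\<^sup>2 + (norm (u - a v))\<^sup>2) + sqrt ((L b)\<^sup>2 + (norm (v - b w))\<^sup>2)"
    by (rule real_sqrt_sum_squares_triangle_ineq)
  finally show ?thesis
    using holonomic_dist_le[OF comp_in_H[OF a b], of u w] by linarith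
qed

lemma holonomic_dist_triangle:
  "holonomic_dist H L u w \<le> holonomic_dist H L u v + holonomic_dist H L v w"
proof -
  \<comment> \<open>The two infima are taken one at a time: over \<open>a\<close> with
    \<open>b\<close> fixed, then over \<open>b\<close>.\<close>
  have "holonomic_dist H L u w - sqrt ((L b)\<^sup>2 + (norm (v - b w))\<^sup>2) \<le> holonomic_dist H L u v"
    if "b \<in> H" for b
    by (rule holonomic_dist_greatest) (use holonomic_dist_comp_le[OF _ that] in \<open>simp add: algebra_simps\<close>)
  then have "holonomic_dist H L u w - holonomic_dist H L u v \<le> holonomic_dist H L v w"
    by (intro holonomic_dist_greatest) (simp add: algebra_simps)
  then show ?thesis by simp
qed

lemma holonomic_dist_eq_0_imp_eq:
  assumes "holonomic_dist H L u v = 0"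
  shows "u = v"
proof -
  obtain r where "r > 0" and r: "\<And>v w A. \<lbrakk>A \<in> H; norm v < r; norm w < r\<rbrakk> \<Longrightarrow>
      (norm (v - w))\<^sup>2 - (norm (v - A w))\<^sup>2 \<le> (L A)\<^sup>2"
    using local_estimate[of 0] by auto
  \<comment> \<open>The summand 1 keeps the denominator positive and makes the bounds by
    \<open>r\<close> strict; the cap at 1 ensures that scaling by \<open>t\<close> does not increase
    norms.\<close>
  define t where "t = min 1 (r / (1 + norm u + norm v))"
  have pos: "0 < 1 + norm u + norm v"
    by (simp add: add_pos_nonneg)
  have t: "0 < t" "t \<le> 1"
    using \<open>r > 0\<close> pos by (simp_all add: t_def)
  have "t * (1 + norm u + norm v) \<le> r"
    unfolding pos_le_divide_eq[OF pos, symmetric] t_def by (rule min.cobounded2)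
  moreover have "t * norm u < t * (1 + norm u + norm v)" "t * norm v < t * (1 + norm u + norm v)"
    using t by (auto intro!: mult_strict_left_mono simp: add_pos_nonneg add_nonneg_pos)
  ultimately have "t * norm u < r" "t * norm v < r"
    by linarith+
  then have small: "norm (t *\<^sub>R u) < r" "norm (t *\<^sub>R v) < r"
    using t by simp_all
  have "t * norm (u - v) \<le> e" if "e > 0" for e
  proof -
    obtain a where a: "a \<in> H" and lt: "sqrt ((L a)\<^sup>2 + (norm (u - a v))\<^sup>2) < e"
      using holonomic_dist_lessE[of u v e] assms \<open>e > 0\<close> by auto
    have "t *\<^sub>R u - a (t *\<^sub>R v) = t *\<^sub>R (u - a v)"
      by (simp add: linear_scale[OF linear_H[OF a]] scaleR_diff_right)
    then have "norm (t *\<^sub>R u - a (t *\<^sub>R v)) \<le> norm (u - a v)"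
      using t by (simp add: mult_left_le_one_le)
    then have "(norm (t *\<^sub>R u - a (t *\<^sub>R v)))\<^sup>2 \<le> (norm (u - a v))\<^sup>2"
      by (rule power_mono) simp
    \<comment> \<open>Only the displacement shrinks under scaling, while \<open>L a\<close> stays
      fixed; the bound \<open>t \<le> 1\<close> lets the unscaled cost, which is below
      \<open>e\<close>, dominate both terms.\<close>
    with r[OF a small]
    have "(norm (t *\<^sub>R u - t *\<^sub>R v))\<^sup>2 \<le> (L a)\<^sup>2 + (norm (u - a v))\<^sup>2"
      by linarith
    then have "norm (t *\<^sub>R u - t *\<^sub>R v) \<le> sqrt ((L a)\<^sup>2 + (norm (u - a v))\<^sup>2)"
      by (rule real_le_rsqrt)
    with lt t show ?thesis
      by (simp flip: scaleR_diff_right)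
  qed
  then have "t * norm (u - v) \<le> 0"
    by (rule field_le_epsilon[where y = 0, simplified])
  with t show ?thesis
    by (simp add: mult_le_0_iff)
qed

end

theorem theorem2p7:
  fixes H :: "('v::real_normed_vector \<Rightarrow> 'v) set"
    and L :: "('v \<Rightarrow> 'v) \<Rightarrow> real"
  assumes "holonomic_space H L"
  shows "Metric_space (UNIV :: 'v set) (holonomic_dist H L)"
proof -
  interpret holonomic_space H L by (rule assms)
  show ?thesis
  proof
    show "holonomic_dist H L u v = holonomic_dist H L v u" for u v
      using holonomic_dist_commute_le by (intro antisym)
  qed (auto intro: holonomic_dist_nonneg holonomic_dist_triangle
        simp: holonomic_dist_self dest: holonomic_dist_eq_0_imp_eq)
qed

end
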